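(* Up to transposition, a $(1,3.005589)$-admissible word $\theta$ has the form $$\theta=\dots 2_2\,1_2\,2_4\,1_2\,2_2\,1_2\,2^*\,2_2\,1_2\,2_4\,1_2\,2_2\,1_2\dots$$ In particular, it contains the string $\theta_1^0=2_2\,1_2\,2_4\,1_2\,2_2\,1_2\,2^*\,2_2\,1_2\,2_4\,1_2\,2_2\,1$.
   Context: All words are over the alphabet $\{1,2\}$. Subscripts indicate repetition of a character (e.g. $1_2 2_4$ is $112222$), and an asterisk marks the entry in position $0$; writing $\theta=\dots u\dots$ means that $\theta$ contains the string $u$ with its starred entry at position $0$. For $\theta=(a_n)_{n\in\mathbb{Z}}\in\{1,2\}^{\mathbb{Z}}$ put $\lambda_i(\theta)=[a_i;a_{i+1},a_{i+2},\dots]+[0;a_{i-1},a_{i-2},\dots]$ and $m(\theta)=\sup_{i\in\mathbb{Z}}\lambda_i(\theta)$. For $k\ge1$ let $\underline{\omega}_k=2_{2k}\,1_2\,2_{2k+1}\,1_2\,2_{2k+2}\,1_2$ and let $\theta(\underline{\omega}_k)$ be the bi-infinite periodic word obtained by repeating $\underline{\omega}_k$. A word $\theta\in\{1,2\}^{\mathbb{Z}}$ is $(k,\lambda)$-admissible if $m(\theta(\underline{\omega}_k))<m(\theta)=\lambda_0(\theta)<\lambda$. The transposition of $\theta=(a_n)_{n\in\mathbb{Z}}$ is $(a_{-n})_{n\in\mathbb{Z}}$; "up to transposition" means that $\theta$ or its transposition has the stated form. *)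

theory Defs
  imports "HOL-Analysis.Analysis"
begin

primrec cf_convergent :: "nat \<Rightarrow> (nat \<Rightarrow> nat) \<Rightarrow> real" where
  "cf_convergent 0 a = real (a 0)"
| "cf_convergent (Suc n) a = real (a 0) + 1 / cf_convergent n (\<lambda>i. a (Suc i))"

(* The infinite continued fraction [a 0; a 1, a 2, ...].  The convergents converge
   whenever a i \<ge> 1 for all i \<ge> 1; a 0 may be 0. *)
definition cf :: "(nat \<Rightarrow> nat) \<Rightarrow> real" where
  "cf a = lim (\<lambda>n. cf_convergent n a)"

definition biinf_word :: "(int \<Rightarrow> nat) \<Rightarrow> bool" where
  "biinf_word \<theta> \<longleftrightarrow> (\<forall>n. \<theta> n \<in> {1, 2})"

definition lam :: "int \<Rightarrow> (int \<Rightarrow> nat) \<Rightarrow> real" where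
  "lam i \<theta> = cf (\<lambda>n. \<theta> (i + int n)) + cf (\<lambda>n. if n = 0 then 0 else \<theta> (i - int n))"

(* A real supremum: on words over {1,2} the values of lam are bounded above by 4. *)
definition markov :: "(int \<Rightarrow> nat) \<Rightarrow> real" where
  "markov \<theta> = (SUP i. lam i \<theta>)"

(* Run-length notation: runs [(1, 2), (2, 4)] is the word 1_2 2_4 = 112222. *)
definition runs :: "(nat \<times> nat) list \<Rightarrow> nat list" where
  "runs xs = concat (map (\<lambda>(c, n). replicate n c) xs)"

definition omega :: "nat \<Rightarrow> nat list" where
  "omega k = runs [(2, 2 * k), (1, 2), (2, 2 * k + 1), (1, 2), (2, 2 * k + 2), (1, 2)]"

definition periodic_word :: "nat list \<Rightarrow> int \<Rightarrow> nat" where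
  "periodic_word w n = w ! nat (n mod int (length w))"

definition admissible :: "nat \<Rightarrow> real \<Rightarrow> (int \<Rightarrow> nat) \<Rightarrow> bool" where
  "admissible k l \<theta> \<longleftrightarrow> biinf_word \<theta> \<and>
     markov (periodic_word (omega k)) < markov \<theta> \<and> markov \<theta> = lam 0 \<theta> \<and> lam 0 \<theta> < l"

definition transposition :: "(int \<Rightarrow> nat) \<Rightarrow> (int \<Rightarrow> nat)" where
  "transposition \<theta> = (\<lambda>n. \<theta> (- n))"

(* The word \<theta> has the form ... u v ..., where the first letter of v is the starred one,
   i.e. sits at position 0. *)
definition contains_starred :: "(int \<Rightarrow> nat) \<Rightarrow> nat list \<Rightarrow> nat list \<Rightarrow> bool" where
  "contains_starred \<theta> u v \<longleftrightarrow>
     (\<forall>j < length (u @ v). \<theta> (int j - int (length u)) = (u @ v) ! j)"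

end

(* A finite window of a word over {1,2} confines each lam i to a rational interval, because
   every tail of the continued fraction lies in [1, 3].  Since lam 0 is the supremum, a window
   around position 0 is impossible for an admissible word as soon as some lam i in it is at
   least 3.005589, or lam 0 is at most 3.005587312, a number just below the Markov value
   3.0055873124... of the periodic word.  Extending the window letter by letter, these two
   obstructions kill all branches except the asserted window and its transposition. *)
theory Submission
  imports Defs
begin

section \<open>Convergence of continued fractions with letters 1 and 2\<close>

lemma cf_convergent_bounds:
  assumes "\<And>i. a i \<in> {1, 2}"
  shows "1 \<le> cf_convergent n a" "cf_convergent n a \<le> 3"
proof -
  have "1 \<le> cf_convergent n a \<and> cf_convergent n a \<le> 3"
    using assms
  proof (induction n arbitrary: a)
    case 0
    from 0[of 0] show ?case by auto
  next
    case (Suc n)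
    have "1 \<le> cf_convergent n (\<lambda>i. a (Suc i))" by (rule Suc.IH[THEN conjunct1, OF Suc.prems])
    then show ?case using Suc.prems[of 0] by (auto simp: field_simps)
  qed
  then show "1 \<le> cf_convergent n a" "cf_convergent n a \<le> 3" by auto
qed

text \<open>Since the tail is at most 3, one step of the recursion lifts the convergent off 1. The
  gap yields a contraction factor below 1.\<close>

lemma cf_convergent_Suc_ge:
  assumes "\<And>i. a i \<in> {1, 2}"
  shows "4 / 3 \<le> cf_convergent (Suc n) a"
proof -
  have "1 / 3 \<le> 1 / cf_convergent n (\<lambda>i. a (Suc i))"
    using cf_convergent_bounds[of "\<lambda>i. a (Suc i)" n, OF assms] by (intro divide_left_mono) auto
  then show ?thesis using assms[of 0] by auto
qed

text \<open>Taking reciprocals divides a difference by the product of the two tails, which is at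
  least (4/3)^2 = 16/9. The starting constant 2 is the length of [1, 3]. The shift to
  \<open>Suc N\<close> ensures that in the inductive step both tails are themselves convergents of
  positive index, as the bound 4/3 requires.\<close>

lemma cf_convergent_contraction:
  assumes "\<And>i. a i \<in> {1, 2}" "Suc N \<le> m" "Suc N \<le> n"
  shows "\<bar>cf_convergent m a - cf_convergent n a\<bar> \<le> 2 * (9 / 16) ^ N"
  using assms
proof (induction N arbitrary: a m n)
  case 0
  then show ?case
    using cf_convergent_bounds[of a m, OF 0(1)] cf_convergent_bounds[of a n, OF 0(1)] by simp
next
  case (Suc N)
  obtain m' n' where mn: "m = Suc (Suc m')" "n = Suc (Suc n')"
    using Suc.prems by (metis Suc_le_D Suc_le_mono)
  define b where "b = (\<lambda>i. a (Suc i))"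
  have b: "\<And>i. b i \<in> {1, 2}" using Suc.prems(1) by (simp add: b_def)
  define x y where "x = cf_convergent (Suc m') b" and "y = cf_convergent (Suc n') b"
  have x: "4 / 3 \<le> x" and y: "4 / 3 \<le> y"
    unfolding x_def y_def by (intro cf_convergent_Suc_ge b)+
  have "(4 / 3) * (4 / 3) \<le> x * y"
    using x y by (intro mult_mono) auto
  then have xy: "16 / 9 \<le> x * y" by simp
  have IH: "\<bar>y - x\<bar> \<le> 2 * (9 / 16) ^ N"
    unfolding x_def y_def using Suc.prems mn by (intro Suc.IH b) auto
  have "cf_convergent m a - cf_convergent n a = 1 / x - 1 / y"
    by (simp add: mn x_def y_def b_def)
  also have "\<dots> = (y - x) / (x * y)" using x y by (simp add: field_simps)
  finally have "\<bar>cf_convergent m a - cf_convergent n a\<bar> = \<bar>y - x\<bar> / (x * y)"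
    using x y by (simp add: abs_mult)
  also have "\<dots> \<le> (2 * (9 / 16) ^ N) / (16 / 9)"
    using IH xy by (intro frac_le) auto
  finally show ?case by simp
qed

lemma cf_convergent_tendsto_cf:
  assumes "\<And>i. a i \<in> {1, 2}"
  shows "(\<lambda>n. cf_convergent n a) \<longlonglongrightarrow> cf a"
proof -
  have "Cauchy (\<lambda>n. cf_convergent n a)"
  proof (rule metric_CauchyI)
    fix e :: real assume "e > 0"
    have "(\<lambda>N. 2 * (9 / 16 :: real) ^ N) \<longlonglongrightarrow> 2 * 0"
      by (intro tendsto_intros LIMSEQ_power_zero) auto
    then have "\<forall>\<^sub>F N in sequentially. 2 * (9 / 16 :: real) ^ N < e"
      using \<open>e > 0\<close> by (intro order_tendstoD(2)) auto
    then obtain N where "2 * (9 / 16 :: real) ^ N < e"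
      by (auto simp: eventually_sequentially)
    then have "\<forall>m\<ge>Suc N. \<forall>n\<ge>Suc N. dist (cf_convergent m a) (cf_convergent n a) < e"
      using cf_convergent_contraction[of a N, OF assms] by (fastforce simp: dist_real_def)
    then show "\<exists>M. \<forall>m\<ge>M. \<forall>n\<ge>M. dist (cf_convergent m a) (cf_convergent n a) < e" by blast
  qed
  then show ?thesis
    unfolding cf_def by (simp add: Cauchy_convergent_iff convergent_LIMSEQ_iff)
qed

section \<open>Enclosures of continued fractions from finite prefixes\<close>

lemma cf_bounds:
  assumes "\<And>i. a i \<in> {1, 2}"
  shows "1 \<le> cf a" "cf a \<le> 3"
proof -
  note lim = cf_convergent_tendsto_cf[of a, OF assms]
  show "1 \<le> cf a"
    using cf_convergent_bounds(1)[of a, OF assms] by (intro LIMSEQ_le_const[OF lim]) auto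
  show "cf a \<le> 3"
    using cf_convergent_bounds(2)[of a, OF assms] by (intro LIMSEQ_le_const2[OF lim]) auto
qed

text \<open>The leading letter is left free so that the expansion [0; ...] in \<open>lam\<close> is
  covered.\<close>

lemma cf_unfold:
  assumes "\<And>i. a (Suc i) \<in> {1, 2}"
  shows "cf a = real (a 0) + 1 / cf (\<lambda>i. a (Suc i))"
proof -
  let ?b = "\<lambda>i. a (Suc i)"
  have "(\<lambda>n. cf_convergent (Suc n) a) \<longlonglongrightarrow> real (a 0) + 1 / cf ?b"
    using cf_bounds(1)[of ?b, OF assms]
    by (auto intro!: tendsto_intros cf_convergent_tendsto_cf assms)
  then have "(\<lambda>n. cf_convergent n a) \<longlonglongrightarrow> real (a 0) + 1 / cf ?b"
    by (rule LIMSEQ_imp_Suc)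
  then show ?thesis unfolding cf_def by (rule limI)
qed

text \<open>The recursion is mutual because a reciprocal swaps lower and upper bounds; the base
  values 1 and 3 enclose an unknown tail.\<close>

fun cf_lo :: "nat list \<Rightarrow> real" and cf_hi :: "nat list \<Rightarrow> real" where
  "cf_lo [] = 1"
| "cf_lo (x # xs) = real x + 1 / cf_hi xs"
| "cf_hi [] = 3"
| "cf_hi (x # xs) = real x + 1 / cf_lo xs"

text \<open>Positivity is carried through the induction because reciprocals reverse the order only
  between numbers of equal sign.\<close>

lemma cf_prefix_bounds:
  assumes "\<And>i. a i \<in> {1, 2}" "\<And>i. i < length w \<Longrightarrow> a i = w ! i"
  shows "0 < cf_lo w \<and> cf_lo w \<le> cf a \<and> cf a \<le> cf_hi w"
  using assms
proof (induction w arbitrary: a)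
  case Nil
  then show ?case using cf_bounds[of a, OF Nil(1)] by simp
next
  case (Cons x w)
  let ?b = "\<lambda>i. a (Suc i)"
  have IH: "0 < cf_lo w" "cf_lo w \<le> cf ?b" "cf ?b \<le> cf_hi w"
    using Cons.IH[of ?b] Cons.prems(1) Cons.prems(2)[of "Suc _"] by auto
  have "a 0 = x" using Cons.prems(2)[of 0] by simp
  then have "cf a = real x + 1 / cf ?b"
    using cf_unfold[of a] Cons.prems(1) by simp
  moreover have "1 / cf_hi w \<le> 1 / cf ?b" "1 / cf ?b \<le> 1 / cf_lo w"
    using IH by (auto intro!: divide_left_mono)
  moreover have "0 < real x + 1 / cf_hi w" using IH by (intro add_nonneg_pos) auto
  ultimately show ?case by simp
qed

section \<open>The values \<open>lam\<close> and their bounds on windows\<close>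

lemma lam_eq:
  assumes "biinf_word \<theta>"
  shows "lam i \<theta> = cf (\<lambda>n. \<theta> (i + int n)) + 1 / cf (\<lambda>n. \<theta> (i - 1 - int n))"
proof -
  have "cf (\<lambda>n. if n = 0 then 0 else \<theta> (i - int n)) = 1 / cf (\<lambda>n. \<theta> (i - 1 - int n))"
    using assms by (subst cf_unfold) (auto simp: biinf_word_def algebra_simps)
  then show ?thesis by (simp add: lam_def)
qed

lemma lam_le_markov:
  assumes "biinf_word \<theta>"
  shows "lam i \<theta> \<le> markov \<theta>"
  unfolding markov_def
proof (rule cSUP_upper)
  show "bdd_above (range (\<lambda>i. lam i \<theta>))"
  proof (rule bdd_aboveI2)
    fix j
    have letters: "\<And>n. \<theta> n \<in> {1, 2}" using assms by (simp add: biinf_word_def)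
    have "1 / cf (\<lambda>n. \<theta> (j - 1 - int n)) \<le> 1"
      using cf_bounds(1)[of "\<lambda>n. \<theta> (j - 1 - int n)", OF letters] by simp
    then show "lam j \<theta> \<le> 4"
      using cf_bounds(2)[of "\<lambda>n. \<theta> (j + int n)", OF letters] by (simp add: lam_eq[OF assms])
  qed
qed simp

text \<open>The index \<open>k\<close> counts from the left end of the window. The prefix before it
  is reversed because the backward half is read leftwards from letter \<open>k - 1\<close>.\<close>

lemma lam_bounds:
  assumes "biinf_word \<theta>" "contains_starred \<theta> u v" "k \<le> length (u @ v)"
  defines "l \<equiv> rev (take k (u @ v))" and "r \<equiv> drop k (u @ v)"
  shows "cf_lo r + 1 / cf_hi l \<le> lam (int k - int (length u)) \<theta>"
    and "lam (int k - int (length u)) \<theta> \<le> cf_hi r + 1 / cf_lo l"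
proof -
  define i where "i = int k - int (length u)"
  have letters: "\<And>n. \<theta> n \<in> {1, 2}" using assms by (simp add: biinf_word_def)
  have window: "\<theta> (int j - int (length u)) = (u @ v) ! j" if "j < length (u @ v)" for j
    using assms(2) that by (auto simp: contains_starred_def)
  have right: "\<theta> (i + int n) = r ! n" if "n < length r" for n
    using window[of "k + n"] that assms(3)
    by (simp add: r_def i_def algebra_simps del: drop_append)
  have left: "\<theta> (i - 1 - int n) = l ! n" if "n < length l" for n
  proof -
    have "n < k" using that assms(3) by (simp add: l_def)
    then have "l ! n = (u @ v) ! (k - Suc n)"
      using assms(3) by (simp add: l_def rev_nth min_absorb2 del: take_append)
    moreover have "i - 1 - int n = int (k - Suc n) - int (length u)"
      using \<open>n < k\<close> by (simp add: i_def)
    moreover have "k - Suc n < length (u @ v)" using \<open>n < k\<close> assms(3) by linarith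
    ultimately show ?thesis using window by metis
  qed
  have r: "cf_lo r \<le> cf (\<lambda>n. \<theta> (i + int n))" "cf (\<lambda>n. \<theta> (i + int n)) \<le> cf_hi r"
    using cf_prefix_bounds[of "\<lambda>n. \<theta> (i + int n)" r, OF letters right] by auto
  have l: "0 < cf_lo l" "cf_lo l \<le> cf (\<lambda>n. \<theta> (i - 1 - int n))"
    "cf (\<lambda>n. \<theta> (i - 1 - int n)) \<le> cf_hi l"
    using cf_prefix_bounds[of "\<lambda>n. \<theta> (i - 1 - int n)" l, OF letters left] by auto
  have "1 / cf_hi l \<le> 1 / cf (\<lambda>n. \<theta> (i - 1 - int n))"
    "1 / cf (\<lambda>n. \<theta> (i - 1 - int n)) \<le> 1 / cf_lo l"
    using l by (auto intro!: divide_left_mono)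
  with r show "cf_lo r + 1 / cf_hi l \<le> lam (int k - int (length u)) \<theta>"
    "lam (int k - int (length u)) \<theta> \<le> cf_hi r + 1 / cf_lo l"
    unfolding i_def[symmetric] lam_eq[OF assms(1)] by linarith+
qed

section \<open>The Markov value of the periodic word\<close>

lemma nth_concat_replicate:
  "j < n * length w \<Longrightarrow> concat (replicate n w) ! j = w ! (j mod length w)"
  by (induction n arbitrary: j) (auto simp: nth_append le_mod_geq)

text \<open>One index suffices, since the supremum dominates every \<open>lam\<close>. Three periods
  of length 15 leave enough letters on both sides of the middle copy for this precision.\<close>

lemma markov_omega_1: "3.005587312 \<le> markov (periodic_word (omega 1))"
proof -
  let ?p = "periodic_word (omega 1)"
  have omega: "omega 1 = [2, 2, 1, 1, 2, 2, 2, 1, 1, 2, 2, 2, 2, 1, 1]"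
    by (simp add: omega_def runs_def numeral_eq_Suc)
  define w where "w = concat (replicate 3 (omega 1))"
  have w: "w = omega 1 @ omega 1 @ omega 1" by (simp add: w_def numeral_eq_Suc)
  have word: "biinf_word ?p"
  proof -
    have "set (omega 1) \<subseteq> {1, 2}" unfolding omega by simp
    moreover have "nat (n mod int (length (omega 1))) < length (omega 1)" for n
      unfolding omega by (simp add: nat_less_iff)
    ultimately show ?thesis
      unfolding biinf_word_def periodic_word_def using nth_mem by blast
  qed
  have "length w = 3 * length (omega 1)" by (simp add: w)
  then have "contains_starred ?p [] w"
    by (simp add: contains_starred_def periodic_word_def w_def nth_concat_replicate nat_mod_distrib)
  \<comment> \<open>The maximum is attained at index 4 of the period; 19 = 4 + 15 is its middle copy.\<close>
  moreover have "19 \<le> length w" unfolding w omega by simp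
  ultimately have "cf_lo (drop 19 w) + 1 / cf_hi (rev (take 19 w)) \<le> lam 19 ?p"
    using lam_bounds(1)[OF word, of "[]" w 19] by simp
  moreover have "3.005587312 \<le> cf_lo (drop 19 w) + 1 / cf_hi (rev (take 19 w))"
    unfolding w omega by simp
  ultimately show ?thesis using lam_le_markov[OF word, of 19] by linarith
qed

section \<open>Reversing and extending windows\<close>

lemma contains_starred_transposition:
  assumes "contains_starred \<theta> (rev v) (x # rev u)"
  shows "contains_starred (transposition \<theta>) u (x # v)"
  unfolding contains_starred_def
proof (intro allI impI)
  fix j assume j: "j < length (u @ x # v)"
  let ?w = "u @ x # v"
  have rev: "rev ?w = rev v @ x # rev u" by simp
  let ?k = "length ?w - Suc j"
  have "rev ?w ! ?k = ?w ! j" using j by (subst rev_nth) auto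
  moreover have "\<theta> (int ?k - int (length v)) = rev ?w ! ?k"
  proof -
    have "?k < length (rev v @ x # rev u)" using j by simp
    then show ?thesis using assms unfolding rev contains_starred_def length_rev by blast
  qed
  \<comment> \<open>The starred letter \<open>x\<close> counts for neither \<open>u\<close> nor
    \<open>v\<close>, so reversal keeps it at position 0 and negates every position.\<close>
  moreover have "int ?k - int (length v) = - (int j - int (length u))"
    using j by auto
  ultimately show "transposition \<theta> (int j - int (length u)) = ?w ! j"
    by (simp add: transposition_def)
qed

lemma contains_starred_prefix: "contains_starred \<theta> u (v @ v') \<Longrightarrow> contains_starred \<theta> u v"
  unfolding contains_starred_def append_assoc[symmetric]
  by (auto simp: nth_append simp del: append_assoc)

lemma contains_starred_extend_right:
  assumes "biinf_word \<theta>" "contains_starred \<theta> u v"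
  obtains x where "x \<in> {1, 2}" "contains_starred \<theta> u (v @ [x])"
proof
  \<comment> \<open>The window fills positions \<open>- length u\<close> to
    \<open>length v - 1\<close>.\<close>
  let ?x = "\<theta> (int (length v))"
  show "?x \<in> {1, 2}" using assms by (simp add: biinf_word_def)
  show "contains_starred \<theta> u (v @ [?x])"
    using assms(2) unfolding contains_starred_def append_assoc[symmetric]
    by (auto simp: nth_append less_Suc_eq simp del: append_assoc)
qed

lemma contains_starred_extend_left:
  assumes "biinf_word \<theta>" "contains_starred \<theta> u v"
  obtains x where "x \<in> {1, 2}" "contains_starred \<theta> (x # u) v"
proof
  let ?x = "\<theta> (- 1 - int (length u))"
  show "?x \<in> {1, 2}" using assms by (simp add: biinf_word_def)
  show "contains_starred \<theta> (?x # u) v"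
    unfolding contains_starred_def
  proof (intro allI impI)
    fix j assume "j < length ((?x # u) @ v)"
    then show "\<theta> (int j - int (length (?x # u))) = ((?x # u) @ v) ! j"
      using assms(2) by (cases j) (auto simp: contains_starred_def)
  qed
qed

section \<open>The certified finite search\<close>

text \<open>Certificates for the finite search: \<open>Low\<close> closes a branch by the upper bound on
  \<open>lam 0\<close>, \<open>Peak k\<close> by the lower bound on \<open>lam\<close> at the \<open>k\<close>-th letter of the window (counted
  from its left end, starting at 0), and \<open>Left\<close>, \<open>Right\<close> branch on the next letter on that side.\<close>

datatype cert = Goal | Low | Peak nat | Left cert cert | Right cert cert

text \<open>In the target window this word stands on both sides of the starred 2.\<close>

definition flank :: "nat list" where
  "flank = [2, 2, 1, 1, 2, 2, 2, 2, 1, 1, 2, 2, 1, 1]"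

fun check :: "cert \<Rightarrow> nat list \<Rightarrow> nat list \<Rightarrow> bool" where
  "check Goal u v \<longleftrightarrow> u = flank \<and> v = 2 # flank \<or> u = rev flank \<and> v = 2 # rev flank"
| "check Low u v \<longleftrightarrow> cf_hi v + 1 / cf_lo (rev u) \<le> 3.005587312"
| "check (Peak k) u v \<longleftrightarrow> k \<le> length (u @ v) \<and>
     3.005589 \<le> cf_lo (drop k (u @ v)) + 1 / cf_hi (rev (take k (u @ v)))"
| "check (Left c d) u v \<longleftrightarrow> check c (1 # u) v \<and> check d (2 # u) v"
| "check (Right c d) u v \<longleftrightarrow> check c u (v @ [1]) \<and> check d u (v @ [2])"

text \<open>A \<open>Low\<close> leaf contradicts that \<open>lam 0\<close> exceeds the Markov value
  of the periodic word, and a \<open>Peak\<close> leaf that all \<open>lam\<close> stay below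
  3.005589. Branching is exhaustive over the two letters, so only \<open>Goal\<close> leaves
  survive; the mirrored window there is undone by transposition.\<close>

lemma check_sound:
  assumes "admissible 1 3.005589 \<theta>" "check c u v" "contains_starred \<theta> u v"
  shows "\<exists>\<phi> \<in> {\<theta>, transposition \<theta>}. contains_starred \<phi> flank (2 # flank)"
  using assms(2,3)
proof (induction c arbitrary: u v)
  case Goal
  then show ?case using contains_starred_transposition[of \<theta> flank 2 flank] by auto
next
  case Low
  \<comment> \<open>The index \<open>length u\<close> is that of the starred letter, so its position
    is 0.\<close>
  have "lam 0 \<theta> \<le> 3.005587312"
    using lam_bounds(2)[of \<theta> u v "length u"] assms(1) Low by (simp add: admissible_def)
  then show ?case using markov_omega_1 assms(1) by (simp add: admissible_def)
next
  case (Peak k)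
  have "3.005589 \<le> lam (int k - int (length u)) \<theta>"
    using lam_bounds(1)[of \<theta> u v k] assms(1) Peak by (simp add: admissible_def)
  also have "\<dots> \<le> markov \<theta>" using assms(1) by (intro lam_le_markov) (simp add: admissible_def)
  finally show ?case using assms(1) by (simp add: admissible_def)
next
  case (Left c d)
  then show ?case
    using contains_starred_extend_left[of \<theta> u v] assms(1)
    by (metis admissible_def check.simps(4) insertE singletonD)
next
  case (Right c d)
  then show ?case
    using contains_starred_extend_right[of \<theta> u v] assms(1)
    by (metis admissible_def check.simps(5) insertE singletonD)
qed

text \<open>Found by a computer search minimising the number of nodes.\<close>

definition cert :: cert where
  "cert =
    Right Low (Left (Left (Right (Peak 2) (Left (Right (Right (Left (Left (Right Low (Left
    (Right (Peak 10) (Left Low Low)) (Peak 6))) Low) (Right (Peak 4) (Peak 4))) (Peak 4))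
    (Peak 3)) (Left (Peak 1) (Right Low (Right (Right (Right (Peak 6) (Left (Left (Right
    (Peak 11) (Left (Peak 7) (Left (Peak 1) (Right (Peak 8) (Left (Left (Right (Right (Left
    (Left (Right Low (Right (Peak 22) (Left Low Low))) (Peak 4)) Low) Low) (Peak 10)) (Peak 2))
    (Right Low (Right (Right (Left Low (Right (Peak 18) (Left (Left (Left (Peak 3) (Left
    (Peak 1) (Right Low (Right (Right Goal (Peak 26)) Low)))) (Peak 2)) Low))) (Peak 17))
    Low))))))) (Peak 6)) Low)) (Peak 4)) Low))))) (Peak 2)) (Right (Right (Left (Left (Right
    (Right (Right (Left Low (Left (Peak 1) (Right (Right Low Low) (Peak 5)))) Low) (Left
    (Peak 4) (Peak 4))) Low) (Peak 2)) (Right (Peak 2) (Left (Left (Left (Peak 3) (Left (Peak 1)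
    (Right Low (Right (Right (Right (Peak 6) (Right (Peak 13) (Left (Peak 7) (Right (Right (Left
    (Left (Left (Peak 3) (Left (Peak 1) (Right (Right (Right Low Low) (Peak 19)) Low))) Low)
    (Peak 8)) (Peak 15)) (Left Low (Left (Left (Left (Peak 3) (Left (Peak 1) (Right Low (Right
    (Right (Right (Peak 22) (Left (Left (Right (Peak 27) Goal) (Peak 2)) Low)) (Peak 22))
    Low)))) (Peak 2)) Low)))))) (Peak 6)) Low)))) (Peak 2)) Low))) (Peak 1)) Low))"

text \<open>Evaluation reduces to comparisons of rationals. The search starts from the empty window,
  so even the starred letter is found: a 1 there gives \<open>lam 0\<close> at most 3. The two
  \<open>Goal\<close> leaves are the target and its mirror image.\<close>

lemma check_cert: "check cert [] []"
  by (simp add: cert_def flank_def)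

theorem lemma4p8:
  fixes \<theta> :: "int \<Rightarrow> nat"
  assumes "admissible 1 3.005589 \<theta>"
  shows "\<exists>\<phi> \<in> {\<theta>, transposition \<theta>}.
    contains_starred \<phi>
      (runs [(2,2), (1,2), (2,4), (1,2), (2,2), (1,2)])
      (runs [(2,1), (2,2), (1,2), (2,4), (1,2), (2,2), (1,2)]) \<and>
    contains_starred \<phi>
      (runs [(2,2), (1,2), (2,4), (1,2), (2,2), (1,2)])
      (runs [(2,1), (2,2), (1,2), (2,4), (1,2), (2,2), (1,1)])"
proof -
  have left: "runs [(2,2), (1,2), (2,4), (1,2), (2,2), (1,2)] = flank"
    by (simp add: runs_def flank_def numeral_eq_Suc)
  have right: "runs [(2,1), (2,2), (1,2), (2,4), (1,2), (2,2), (1,2)] = 2 # flank"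
    by (simp add: runs_def flank_def numeral_eq_Suc)
  have right': "runs [(2,1), (2,2), (1,2), (2,4), (1,2), (2,2), (1,1)] = butlast (2 # flank)"
    by (simp add: runs_def flank_def numeral_eq_Suc)
  \<comment> \<open>The second required string is the window without its last letter.\<close>
  have prefix: "contains_starred \<phi> u (butlast v)" if "contains_starred \<phi> u v" for \<phi> u v
    using that contains_starred_prefix[of \<phi> u "butlast v" "drop (length v - 1) v"]
    by (simp add: butlast_conv_take)
  have "contains_starred \<theta> [] []" by (simp add: contains_starred_def)
  then show ?thesis
    unfolding left right right' using check_sound[OF assms check_cert] prefix by blast
qed

end
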